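(* Let $\alpha\ge 3$, $\beta>0$, $t_0>0$, and let $\Phi:\mathcal H\to\mathbb R$ be twice continuously differentiable and strongly convex. Then $\operatorname{argmin}\Phi$ is reduced to a singleton $\{x^*\}$, and for any solution $x:[t_0,+\infty[\to\mathcal H$ of $$\ddot x(t)+\frac{\alpha}{t}\dot x(t)+\beta\nabla^2\Phi(x(t))\dot x(t)+\nabla\Phi(x(t))=0$$ one has, as $t\to+\infty$, $$\Phi(x(t))-\min_{\mathcal H}\Phi=\mathcal O\left(t^{-\frac{2\alpha}{3}}\right)\qquad\text{and}\qquad\|x(t)-x^*\|=\mathcal O\left(t^{-\frac{\alpha}{3}}\right).$$
   Context: $\mathcal H$ is a real Hilbert space with norm $\|\cdot\|$. $\Phi$ is strongly convex if there exists $\mu>0$ such that $\Phi-\frac{\mu}{2}\|\cdot\|^2$ is convex. A solution $x$ of the differential equation is a twice continuously differentiable function satisfying it for all $t\ge t_0$. *)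

theory Defs
  imports "HOL-Analysis.Analysis" "HOL-Library.Landau_Symbols"
begin

text \<open>
  A real Hilbert space is a type of sort \<open>{real_inner, complete_space}\<close>; no bound on the
  dimension and no separability is assumed.
\<close>

text \<open>
  Twice continuous differentiability on the whole space, in the Frechet sense: the first and
  second derivatives take values in spaces of bounded linear maps with the operator norm.
\<close>
definition twice_continuously_differentiable ::
  "('a::real_normed_vector \<Rightarrow> 'b::real_normed_vector) \<Rightarrow> bool" where
  "twice_continuously_differentiable f \<longleftrightarrow>
    (\<exists>(D :: 'a \<Rightarrow> 'a \<Rightarrow>\<^sub>L 'b) (D2 :: 'a \<Rightarrow> 'a \<Rightarrow>\<^sub>L ('a \<Rightarrow>\<^sub>L 'b)).
      (\<forall>x. (f has_derivative blinfun_apply (D x)) (at x)) \<and>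
      (\<forall>x. (D has_derivative blinfun_apply (D2 x)) (at x)) \<and>
      continuous_on UNIV D2)"

definition strongly_convex :: "('a::real_inner \<Rightarrow> real) \<Rightarrow> bool" where
  "strongly_convex f \<longleftrightarrow> (\<exists>\<mu>>0. convex_on UNIV (\<lambda>x. f x - \<mu> / 2 * (norm x)\<^sup>2))"

text \<open>
  The gradient is the Riesz representative of the derivative. It exists at every point of
  differentiability because the space is complete.
\<close>
definition grad :: "('a::real_inner \<Rightarrow> real) \<Rightarrow> 'a \<Rightarrow> 'a" where
  "grad f x = (THE g. GDERIV f x :> g)"

text \<open>The Hessian as a linear operator on the space: the derivative of the gradient map.\<close>
definition hessian :: "('a::real_inner \<Rightarrow> real) \<Rightarrow> 'a \<Rightarrow> 'a \<Rightarrow> 'a" where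
  "hessian f x = frechet_derivative (grad f) (at x)"

definition argmin :: "('a \<Rightarrow> real) \<Rightarrow> 'a set" where
  "argmin f = {x. is_arg_min f (\<lambda>_. True) x}"

text \<open>
  Solutions are twice continuously differentiable on the closed half-line, with one-sided
  derivatives at \<open>t0\<close>. Only the values of \<open>x\<close> on \<open>{t0..}\<close> matter; \<open>v\<close> and \<open>a\<close> are the first and
  second derivatives of \<open>x\<close>.
\<close>
definition is_solution ::
  "real \<Rightarrow> real \<Rightarrow> real \<Rightarrow> ('a::real_inner \<Rightarrow> real) \<Rightarrow> (real \<Rightarrow> 'a) \<Rightarrow> bool" where
  "is_solution \<alpha> \<beta> t0 \<Phi> x \<longleftrightarrow>
    (\<exists>v a.
      (\<forall>t\<ge>t0. (x has_vector_derivative v t) (at t within {t0..})) \<and>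
      (\<forall>t\<ge>t0. (v has_vector_derivative a t) (at t within {t0..})) \<and>
      continuous_on {t0..} a \<and>
      (\<forall>t\<ge>t0. a t + (\<alpha> / t) *\<^sub>R v t + \<beta> *\<^sub>R hessian \<Phi> (x t) (v t) + grad \<Phi> (x t) = 0))"

end

theory Submission
  imports Defs "HOL-Real_Asymp.Real_Asymp"
begin

text \<open>
  With \<open>r = \<alpha>/3\<close>, \<open>z = x - x*\<close>, \<open>F = \<Phi>(x) - min \<Phi>\<close> and \<open>y = 2r z + t (x' + \<beta> \<nabla>\<Phi>(x))\<close>, the energy
  \<open>t\<^bsup>2r-2\<^esup> ((t\<^sup>2 - \<beta>rt) F + \<bar>y\<bar>\<^sup>2/2 - r(r-1) \<bar>z\<bar>\<^sup>2)\<close> is eventually nonincreasing. Its weights are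
  chosen so that in its derivative the terms in \<open>\<bar>x'\<bar>\<^sup>2\<close>, \<open>\<langle>z, x'\<rangle>\<close> and \<open>\<langle>\<nabla>\<Phi>(x), x'\<rangle>\<close> cancel;
  the remaining positive terms are absorbed for large \<open>t\<close> by
  \<open>\<langle>\<nabla>\<Phi>(x), z\<rangle> \<ge> F + \<mu>/2 \<bar>z\<bar>\<^sup>2\<close> and \<open>\<bar>\<nabla>\<Phi>(x)\<bar>\<^sup>2 \<ge> 2\<mu>F\<close>. Since \<open>\<mu>/2 \<bar>z\<bar>\<^sup>2 \<le> F\<close>, the energy
  eventually dominates \<open>t\<^bsup>2r\<^esup> F/2\<close>.
\<close>

section \<open>Strongly convex functions: tangent bound and existence of a minimum\<close>

text \<open>On the line through \<open>x\<close> and \<open>y\<close>, the convex function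
  \<open>h\<close> lies above its tangent at parameter 0. Evaluating at parameter 1, the quadratic
  terms collect to \<open>\<mu> / 2 * (norm (y - x))\<^sup>2\<close>.\<close>

lemma strongly_convex_above_tangent:
  fixes f :: "'a::real_inner \<Rightarrow> real"
  assumes "convex_on UNIV (\<lambda>x. f x - \<mu> / 2 * (norm x)\<^sup>2)"
    and "(f has_derivative f') (at x)"
  shows "f x + f' (y - x) + \<mu> / 2 * (norm (y - x))\<^sup>2 \<le> f y"
proof -
  define h where "h = (\<lambda>x. f x - \<mu> / 2 * (norm x)\<^sup>2)"
  define \<phi> where "\<phi> = (\<lambda>s::real. h (x + s *\<^sub>R (y - x)))"
  have lin: "bounded_linear f'"
    using assms(2) by (rule has_derivative_bounded_linear)
  have "convex_on UNIV \<phi>"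
  proof (rule convex_onI)
    fix t u s :: real assume "0 < t" "t < 1"
    have "x + ((1 - t) *\<^sub>R u + t *\<^sub>R s) *\<^sub>R (y - x) =
        (1 - t) *\<^sub>R (x + u *\<^sub>R (y - x)) + t *\<^sub>R (x + s *\<^sub>R (y - x))"
      by (simp add: algebra_simps)
    then show "\<phi> ((1 - t) *\<^sub>R u + t *\<^sub>R s) \<le> (1 - t) * \<phi> u + t * \<phi> s"
      using convex_onD[OF assms(1), of t "x + u *\<^sub>R (y - x)" "x + s *\<^sub>R (y - x)"] \<open>0 < t\<close> \<open>t < 1\<close>
      by (simp add: \<phi>_def h_def)
  qed simp
  moreover have "(\<phi> has_real_derivative f' (y - x) - \<mu> * (x \<bullet> (y - x))) (at 0)"
  proof -
    have f: "(f has_derivative f') (at (x + 0 *\<^sub>R (y - x)))"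
      using assms(2) by simp
    have "((\<lambda>s. x + s *\<^sub>R (y - x)) has_derivative (\<lambda>s. s *\<^sub>R (y - x))) (at 0)"
      by (auto intro!: derivative_eq_intros)
    from has_derivative_compose[OF this f]
    have "((\<lambda>s. f (x + s *\<^sub>R (y - x))) has_derivative (\<lambda>s. f' (s *\<^sub>R (y - x)))) (at 0)" .
    then have 1: "((\<lambda>s. f (x + s *\<^sub>R (y - x))) has_real_derivative f' (y - x)) (at 0)"
      by (simp add: has_field_derivative_def linear_cmul[OF bounded_linear.linear[OF lin]]
          mult_commute_abs)
    have 2: "((\<lambda>s. (norm (x + s *\<^sub>R (y - x)))\<^sup>2) has_real_derivative 2 * (x \<bullet> (y - x))) (at 0)"
      unfolding power2_norm_eq_inner has_field_derivative_def
      by (auto intro!: derivative_eq_intros simp: algebra_simps inner_commute fun_eq_iff)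
    show ?thesis
      unfolding \<phi>_def h_def by (rule derivative_eq_intros 1 2 refl)+ simp
  qed
  ultimately have "\<phi> 1 \<ge> \<phi> 0 + (f' (y - x) - \<mu> * (x \<bullet> (y - x))) * (1 - 0)"
    using convex_on_imp_above_tangent[of UNIV \<phi> 0 1] by force
  then show ?thesis
    by (simp add: \<phi>_def h_def power2_norm_eq_inner algebra_simps inner_commute)
qed

text \<open>The gain comes from the parallelogram law: the mean of the two squared norms exceeds the
  squared norm of the midpoint by a quarter of \<open>(norm (x - y))\<^sup>2\<close>. This
  quantitative gap makes minimizing sequences Cauchy.\<close>

lemma strongly_convex_midpoint:
  fixes f :: "'a::real_inner \<Rightarrow> real"
  assumes "convex_on UNIV (\<lambda>x. f x - \<mu> / 2 * (norm x)\<^sup>2)"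
  shows "f ((1/2) *\<^sub>R (x + y)) + \<mu> / 8 * (norm (x - y))\<^sup>2 \<le> (f x + f y) / 2"
proof -
  have xy: "(norm (x - y))\<^sup>2 = x \<bullet> x - 2 * (x \<bullet> y) + y \<bullet> y"
    by (simp add: power2_norm_eq_inner inner_diff_left inner_diff_right inner_commute)
  have mid: "(norm ((1/2) *\<^sub>R (x + y)))\<^sup>2 = (x \<bullet> x + 2 * (x \<bullet> y) + y \<bullet> y) / 4"
    unfolding power2_norm_eq_inner by (simp add: inner_add_left inner_add_right inner_commute)
  have "f ((1/2) *\<^sub>R (x + y)) - \<mu> / 2 * (norm ((1/2) *\<^sub>R (x + y)))\<^sup>2
      \<le> (f x - \<mu> / 2 * (x \<bullet> x)) / 2 + (f y - \<mu> / 2 * (y \<bullet> y)) / 2"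
    using convex_onD[OF assms, of "1/2" x y] by (simp add: scaleR_add_right power2_norm_eq_inner)
  then show ?thesis
    unfolding xy mid by (simp add: algebra_simps add_divide_distrib diff_divide_distrib)
qed

text \<open>Completeness takes the place of compactness: a minimizing sequence is Cauchy, and
  continuity carries the infimum to its limit.\<close>

lemma strongly_convex_has_minimum:
  fixes f :: "'a::{real_inner, complete_space} \<Rightarrow> real"
  assumes conv: "convex_on UNIV (\<lambda>x. f x - \<mu> / 2 * (norm x)\<^sup>2)" and "\<mu> > 0"
    and diff: "\<And>x. f differentiable (at x)"
  obtains m where "\<And>y. f m \<le> f y"
proof -
  obtain D where D: "(f has_derivative D) (at 0)"
    using diff unfolding differentiable_def by blast
  obtain K where K: "\<And>h. norm (D h) \<le> norm h * K"
    using bounded_linear.bounded[OF has_derivative_bounded_linear[OF D]] by blast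
  \<comment> \<open>The tangent bound at 0 has a linear term of size at most
    \<open>norm y * K\<close>; completing the square against the quadratic term gives a bound
    independent of \<open>y\<close>.\<close>
  have "f 0 - K\<^sup>2 / (2 * \<mu>) \<le> f y" for y
  proof -
    have "0 \<le> (\<mu> * norm y - K)\<^sup>2 / (2 * \<mu>)"
      using \<open>\<mu> > 0\<close> by simp
    also have "\<dots> = \<mu> / 2 * (norm y)\<^sup>2 - norm y * K + K\<^sup>2 / (2 * \<mu>)"
      using \<open>\<mu> > 0\<close> by (simp add: field_simps power2_eq_square)
    finally show ?thesis
      using strongly_convex_above_tangent[OF conv D, of y] K[of y] by simp
  qed
  then have bdd: "bdd_below (range f)"
    by (rule bdd_belowI2)
  define I where "I = (INF y. f y)"
  have I: "I \<le> f y" for y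
    unfolding I_def by (rule cINF_lower[OF bdd]) simp
  have "\<exists>y. f y < I + inverse (real (Suc n))" for n
  proof (rule ccontr)
    assume "\<not> ?thesis"
    then have "I + inverse (real (Suc n)) \<le> I"
      unfolding I_def by (intro cINF_greatest) (auto simp: not_less)
    moreover have "0 < inverse (real (Suc n))"
      by simp
    ultimately show False by linarith
  qed
  then obtain u where u: "\<And>n. f (u n) < I + inverse (real (Suc n))"
    by metis
  have "Cauchy u"
  proof (rule metric_CauchyI)
    fix e :: real assume "e > 0"
    obtain N where N: "inverse (real (Suc N)) < \<mu> / 8 * e\<^sup>2"
      using reals_Archimedean[of "\<mu> / 8 * e\<^sup>2"] \<open>\<mu> > 0\<close> \<open>e > 0\<close> by auto
    have "dist (u m) (u n) < e" if "m \<ge> N" "n \<ge> N" for m n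
    proof -
      have small: "f (u k) < I + \<mu> / 8 * e\<^sup>2" if "k \<ge> N" for k
      proof -
        have "inverse (real (Suc k)) \<le> inverse (real (Suc N))"
          using that by (simp add: field_simps)
        then show ?thesis using u[of k] N by linarith
      qed
      \<comment> \<open>The value at the midpoint is at least \<open>I\<close>, while the mean of
        the two end values is below \<open>I + \<mu> / 8 * e\<^sup>2\<close>; the midpoint gap must
        fit in between.\<close>
      have "\<mu> / 8 * (norm (u m - u n))\<^sup>2 < \<mu> / 8 * e\<^sup>2"
        using strongly_convex_midpoint[OF conv, of "u m" "u n"] I[of "(1/2) *\<^sub>R (u m + u n)"]
          small[OF that(1)] small[OF that(2)]
        by argo
      then have "(norm (u m - u n))\<^sup>2 < e\<^sup>2"
        using \<open>\<mu> > 0\<close> by simp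
      then show ?thesis
        using \<open>e > 0\<close> by (simp add: dist_norm power2_less_imp_less)
    qed
    then show "\<exists>M. \<forall>m\<ge>M. \<forall>n\<ge>M. dist (u m) (u n) < e"
      by blast
  qed
  then obtain m where m: "u \<longlonglongrightarrow> m"
    using Cauchy_convergent convergentD by blast
  have "isCont f m"
    using diff differentiable_imp_continuous_within by blast
  then have "(\<lambda>n. f (u n)) \<longlonglongrightarrow> f m"
    using m isCont_tendsto_compose by blast
  moreover have "(\<lambda>n. I + inverse (real (Suc n))) \<longlonglongrightarrow> I + 0"
    by (intro tendsto_intros LIMSEQ_inverse_real_of_nat)
  ultimately have "f m \<le> I + 0"
    by (rule LIMSEQ_le) (use u less_imp_le in blast)
  then show thesis
    using I that by (metis add.right_neutral order_trans)
qed

section \<open>Riesz representation, gradient and Hessian\<close>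

text \<open>The Riesz vector of \<open>L\<close> minimizes the strongly convex function \<open>\<bar>x\<bar>\<^sup>2/2 - L x\<close>.\<close>
lemma riesz_representation:
  fixes L :: "'a::{real_inner, complete_space} \<Rightarrow> real"
  assumes "bounded_linear L"
  obtains g where "\<And>h. L h = g \<bullet> h"
proof -
  interpret L: bounded_linear L by fact
  define f where "f = (\<lambda>x. (x \<bullet> x) / 2 - L x)"
  have deriv: "(f has_derivative (\<lambda>h. x \<bullet> h - L h)) (at x)" for x
    unfolding f_def
    by (auto intro!: derivative_eq_intros L.has_derivative simp: inner_commute)
  \<comment> \<open>With modulus 1 the difference is just \<open>- L x\<close>, which is
    linear.\<close>
  have "convex_on UNIV (\<lambda>x. f x - 1 / 2 * (norm x)\<^sup>2)"
    by (rule convex_onI)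
      (simp_all add: f_def power2_norm_eq_inner L.add L.scaleR)
  then obtain m where m: "\<And>y. f m \<le> f y"
    using strongly_convex_has_minimum[of f 1] deriv unfolding differentiable_def by auto
  have "(\<lambda>h. m \<bullet> h - L h) = (\<lambda>h. 0)"
    by (rule has_derivative_local_min[OF deriv]) (use m in simp)
  then show thesis
    using that[of m] by (metis eq_iff_diff_eq_0)
qed

text \<open>As \<open>grad\<close> is a definite description, existence (Riesz) and uniqueness (a
  vector is determined by its inner products) are both required.\<close>

lemma GDERIV_grad:
  fixes f :: "'a::{real_inner, complete_space} \<Rightarrow> real"
  assumes "(f has_derivative f') (at x)"
  shows "GDERIV f x :> grad f x"
proof -
  obtain g where "\<And>h. f' h = g \<bullet> h"
    using riesz_representation has_derivative_bounded_linear[OF assms] by blast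
  then have g: "GDERIV f x :> g"
    using assms unfolding gderiv_def by (metis (lifting) ext inner_commute)
  have "g' = g" if "GDERIV f x :> g'" for g'
  proof -
    have "(\<lambda>h. h \<bullet> g') = (\<lambda>h. h \<bullet> g)"
      using that g unfolding gderiv_def by (rule has_derivative_unique)
    then have "\<forall>h. h \<bullet> g' = h \<bullet> g"
      by (simp add: fun_eq_iff)
    then show ?thesis
      by (simp only: vector_eq_ldot)
  qed
  with g show ?thesis
    unfolding grad_def by (rule theI)
qed

lemma grad_inner:
  fixes f :: "'a::{real_inner, complete_space} \<Rightarrow> real"
  assumes "(f has_derivative f') (at x)"
  shows "grad f x \<bullet> h = f' h"
proof -
  have "(\<lambda>h. h \<bullet> grad f x) = f'"
    using GDERIV_grad[OF assms] assms unfolding gderiv_def by (rule has_derivative_unique)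
  then show ?thesis
    by (auto simp: fun_eq_iff inner_commute)
qed

text \<open>The gradient is \<open>D\<close> followed by the Riesz map \<open>R\<close>, which is
  bounded linear, so it inherits differentiability from \<open>D\<close>. Only then does
  \<open>frechet_derivative\<close> in \<open>hessian\<close> denote a true derivative.\<close>

lemma grad_has_derivative_hessian:
  fixes f :: "'a::{real_inner, complete_space} \<Rightarrow> real"
  assumes D: "\<And>x. (f has_derivative blinfun_apply (D x)) (at x)"
    and D2: "(D has_derivative blinfun_apply D2) (at x)"
  shows "(grad f has_derivative hessian f x) (at x)"
proof -
  define R :: "('a \<Rightarrow>\<^sub>L real) \<Rightarrow> 'a" where "R = (\<lambda>L. SOME g. \<forall>h. blinfun_apply L h = g \<bullet> h)"
  have R: "R L \<bullet> h = blinfun_apply L h" for L h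
  proof -
    have "\<exists>g. \<forall>h. blinfun_apply L h = g \<bullet> h"
      using riesz_representation[OF blinfun.bounded_linear_right, of L] by metis
    then show ?thesis
      unfolding R_def by (rule someI2_ex) simp
  qed
  have eqI: "a = b" if "\<And>h. a \<bullet> h = b \<bullet> h" for a b :: 'a
    using that vector_eq_rdot[of a b] by simp
  have "bounded_linear R"
  proof (rule bounded_linear_intro[where K = 1])
    show "R (L + M) = R L + R M" for L M
      by (rule eqI) (simp add: R inner_left_distrib blinfun.add_left)
    show "R (c *\<^sub>R L) = c *\<^sub>R R L" for c L
      by (rule eqI) (simp add: R blinfun.scaleR_left)
    show "norm (R L) \<le> norm L * 1" for L
    proof (cases "R L = 0")
      case False
      \<comment> \<open>Applying \<open>L\<close> to its own representative shows that the Riesz map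
        does not increase norms.\<close>
      have "norm (R L) * norm (R L) = blinfun_apply L (R L)"
        by (subst R[symmetric]) (simp add: power2_norm_eq_inner[symmetric] power2_eq_square)
      also have "\<dots> \<le> norm L * norm (R L)"
        using norm_blinfun[of L "R L"] by simp
      finally show ?thesis
        using False by simp
    qed simp
  qed
  then have "((\<lambda>x. R (D x)) has_derivative (\<lambda>h. R (blinfun_apply D2 h))) (at x)"
    using D2 by (rule bounded_linear.has_derivative)
  moreover have "grad f = (\<lambda>x. R (D x))"
    by (rule ext, rule eqI) (simp add: R grad_inner[OF D])
  ultimately have "grad f differentiable (at x)"
    unfolding differentiable_def by auto
  then show ?thesis
    unfolding hessian_def by (simp add: frechet_derivative_works)
qed

section \<open>Decay of the energy\<close>

text \<open>Writing the energy as \<open>t powr (2 * r - 2) * G t\<close>, its derivative is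
  \<open>t powr (2 * r - 3)\<close> times \<open>(2 * r - 2) * G t + t * G'\<close>, which is the
  left side here. The acceleration and the Hessian are already eliminated, since the derivative of
  \<open>y\<close> is \<open>(1 - r) *\<^sub>R v - (t - \<beta>) *\<^sub>R g\<close>.\<close>

lemma energy_rate_identity:
  fixes z v g :: "'a::real_inner"
  shows "(2 * r - 2) * ((t\<^sup>2 - \<beta> * r * t) * F
        + ((2 * r) *\<^sub>R z + t *\<^sub>R (v + \<beta> *\<^sub>R g)) \<bullet> ((2 * r) *\<^sub>R z + t *\<^sub>R (v + \<beta> *\<^sub>R g)) / 2
        - r * (r - 1) * (z \<bullet> z))
      + t * ((2 * t - \<beta> * r) * F + (t\<^sup>2 - \<beta> * r * t) * (g \<bullet> v)
        + ((2 * r) *\<^sub>R z + t *\<^sub>R (v + \<beta> *\<^sub>R g)) \<bullet> ((1 - r) *\<^sub>R v - (t - \<beta>) *\<^sub>R g)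
        - 2 * r * (r - 1) * (z \<bullet> v))
    = (2 * r * t\<^sup>2 - (2 * r - 1) * \<beta> * r * t) * F - 2 * r * t * (t - \<beta> * (2 * r - 1)) * (g \<bullet> z)
      - \<beta> * t\<^sup>2 * (t - \<beta> * r) * (g \<bullet> g) + 2 * r * (r - 1) * (r + 1) * (z \<bullet> z)"
proof -
  have "v \<bullet> z = z \<bullet> v" "g \<bullet> z = z \<bullet> g" "v \<bullet> g = g \<bullet> v"
    by (simp_all add: inner_commute)
  then show ?thesis
    by (simp add: inner_add_left inner_add_right inner_diff_right) (simp add: field_simps power2_eq_square)
qed

text \<open>Replacing \<open>g \<bullet> z\<close> by its lower bound cancels the leading
  \<open>2 * r * t\<^sup>2 * F\<close> and leaves \<open>\<beta> * r * (2 * r - 1) * t * F\<close>,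
  which the \<open>g \<bullet> g\<close> term absorbs by the second condition on \<open>t\<close>.
  The third condition lets the negative \<open>z \<bullet> z\<close> term gained by the replacement
  absorb the positive one.\<close>

lemma energy_rate_nonpos:
  fixes z g :: "'a::real_inner"
  assumes "r \<ge> 1" "\<beta> > 0" "\<mu> > 0" "t > 0"
    and F: "F + \<mu> / 2 * (z \<bullet> z) \<le> g \<bullet> z" "0 \<le> F"
    and t: "\<beta> * (2 * r - 1) \<le> t" "r * (2 * r - 1) \<le> 2 * \<mu> * t * (t - \<beta> * r)"
      "2 * (r - 1) * (r + 1) \<le> \<mu> * t * (t - \<beta> * (2 * r - 1))"
  shows "(2 * r * t\<^sup>2 - (2 * r - 1) * \<beta> * r * t) * F - 2 * r * t * (t - \<beta> * (2 * r - 1)) * (g \<bullet> z)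
      - \<beta> * t\<^sup>2 * (t - \<beta> * r) * (g \<bullet> g) + 2 * r * (r - 1) * (r + 1) * (z \<bullet> z) \<le> 0"
proof -
  \<comment> \<open>Expanding this square and inserting the lower bound for
    \<open>g \<bullet> z\<close> gives the Polyak-Lojasiewicz inequality
    \<open>2 * \<mu> * F \<le> g \<bullet> g\<close>.\<close>
  have "0 \<le> (g - \<mu> *\<^sub>R z) \<bullet> (g - \<mu> *\<^sub>R z)"
    by simp
  also have "\<dots> = g \<bullet> g - 2 * \<mu> * (g \<bullet> z) + \<mu>\<^sup>2 * (z \<bullet> z)"
    by (simp add: inner_diff_left inner_diff_right inner_commute power2_eq_square)
  finally have "2 * \<mu> * (F + \<mu> / 2 * (z \<bullet> z)) \<le> g \<bullet> g + \<mu>\<^sup>2 * (z \<bullet> z)"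
    using mult_left_mono[OF F(1), of "2 * \<mu>"] \<open>\<mu> > 0\<close> by linarith
  then have g: "2 * \<mu> * F \<le> g \<bullet> g"
    by (simp add: algebra_simps power2_eq_square)
  have "\<beta> * r \<le> \<beta> * (2 * r - 1)"
    using assms by simp
  then have tr: "\<beta> * r \<le> t"
    using t(1) by linarith
  have 1: "2 * r * t * (t - \<beta> * (2 * r - 1)) * (F + \<mu> / 2 * (z \<bullet> z))
      \<le> 2 * r * t * (t - \<beta> * (2 * r - 1)) * (g \<bullet> z)"
    using assms by (intro mult_left_mono[OF F(1)]) auto
  have 2: "\<beta> * t\<^sup>2 * (t - \<beta> * r) * (2 * \<mu> * F) \<le> \<beta> * t\<^sup>2 * (t - \<beta> * r) * (g \<bullet> g)"
    using assms tr by (intro mult_left_mono[OF g]) auto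
  have 3: "\<beta> * t * F * (r * (2 * r - 1)) \<le> \<beta> * t * F * (2 * \<mu> * t * (t - \<beta> * r))"
    using assms by (intro mult_left_mono[OF t(2)]) auto
  have 4: "r * (z \<bullet> z) * (2 * (r - 1) * (r + 1)) \<le> r * (z \<bullet> z) * (\<mu> * t * (t - \<beta> * (2 * r - 1)))"
    using assms by (intro mult_left_mono[OF t(3)]) auto
  show ?thesis
    using 1 2 3 4 by (simp add: algebra_simps power2_eq_square)
qed

text \<open>The differential equation enters only through the derivative of
  \<open>v + \<beta> *\<^sub>R g\<close>: the Hessian term is the derivative of
  \<open>\<beta> *\<^sub>R g\<close> along the trajectory, so no Hessian appears. The friction
  coefficient is \<open>\<alpha> = 3 * r\<close>.\<close>

lemma hessian_damped_energy_decay: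
  fixes z v g :: "real \<Rightarrow> 'a::real_inner" and F :: "real \<Rightarrow> real"
  assumes r: "r \<ge> 1" and \<beta>: "\<beta> > 0" and \<mu>: "\<mu> > 0"
    and z: "\<And>t. t > t0 \<Longrightarrow> (z has_vector_derivative v t) (at t)"
    and w: "\<And>t. t > t0 \<Longrightarrow>
      ((\<lambda>s. v s + \<beta> *\<^sub>R g s) has_vector_derivative - ((3 * r / t) *\<^sub>R v t) - g t) (at t)"
    and F: "\<And>t. t > t0 \<Longrightarrow> (F has_real_derivative g t \<bullet> v t) (at t)"
    and Fg: "\<And>t. t > t0 \<Longrightarrow> F t + \<mu> / 2 * (z t \<bullet> z t) \<le> g t \<bullet> z t"
    and Fz: "\<And>t. t > t0 \<Longrightarrow> \<mu> / 2 * (z t \<bullet> z t) \<le> F t"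
  shows "F \<in> O[at_top](\<lambda>t. t powr (- (2 * r)))"
proof -
  define y where "y = (\<lambda>t. (2 * r) *\<^sub>R z t + t *\<^sub>R (v t + \<beta> *\<^sub>R g t))"
  define G where "G = (\<lambda>t. (t\<^sup>2 - \<beta> * r * t) * F t + (y t \<bullet> y t) / 2 - r * (r - 1) * (z t \<bullet> z t))"
  define E where "E = (\<lambda>t. t powr (2 * r - 2) * G t)"
  \<comment> \<open>The first three conditions make the energy nonincreasing; the fourth lets it
    dominate \<open>t\<^sup>2 / 2 * F t\<close> after rescaling.\<close>
  have "\<forall>\<^sub>F t in at_top. \<beta> * (2 * r - 1) \<le> t"
    by (rule eventually_ge_at_top)
  moreover have "\<forall>\<^sub>F t in at_top. r * (2 * r - 1) \<le> 2 * \<mu> * t * (t - \<beta> * r)"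
    using r \<beta> \<mu> by real_asymp
  moreover have "\<forall>\<^sub>F t in at_top. 2 * (r - 1) * (r + 1) \<le> \<mu> * t * (t - \<beta> * (2 * r - 1))"
    using r \<beta> \<mu> by real_asymp
  moreover have "\<forall>\<^sub>F t in at_top. \<beta> * r * t + 2 * r * (r - 1) / \<mu> \<le> t\<^sup>2 / 2"
    using r \<beta> \<mu> by real_asymp
  moreover have "\<forall>\<^sub>F t in at_top. t > max t0 0"
    by (rule eventually_gt_at_top)
  ultimately have "\<forall>\<^sub>F t in at_top. t > max t0 0 \<and> \<beta> * (2 * r - 1) \<le> t
      \<and> r * (2 * r - 1) \<le> 2 * \<mu> * t * (t - \<beta> * r)
      \<and> 2 * (r - 1) * (r + 1) \<le> \<mu> * t * (t - \<beta> * (2 * r - 1))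
      \<and> \<beta> * r * t + 2 * r * (r - 1) / \<mu> \<le> t\<^sup>2 / 2"
    by eventually_elim auto
  then obtain T where T: "\<And>t. t \<ge> T \<Longrightarrow> t > t0 \<and> t > 0 \<and> \<beta> * (2 * r - 1) \<le> t
      \<and> r * (2 * r - 1) \<le> 2 * \<mu> * t * (t - \<beta> * r)
      \<and> 2 * (r - 1) * (r + 1) \<le> \<mu> * t * (t - \<beta> * (2 * r - 1))
      \<and> \<beta> * r * t + 2 * r * (r - 1) / \<mu> \<le> t\<^sup>2 / 2"
    unfolding eventually_at_top_linorder by auto
  have nonneg: "0 \<le> F t" if "t > t0" for t
    using Fz[OF that] \<mu> by (meson divide_nonneg_pos inner_ge_zero less_imp_le mult_nonneg_nonneg
        order_trans zero_less_numeral)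
  have dE: "\<exists>d. (E has_real_derivative d) (at t) \<and> d \<le> 0" if "t \<ge> T" for t
  proof -
    note t = T[OF that]
    define G' where "G' = (2 * t - \<beta> * r) * F t + (t\<^sup>2 - \<beta> * r * t) * (g t \<bullet> v t)
        + y t \<bullet> ((1 - r) *\<^sub>R v t - (t - \<beta>) *\<^sub>R g t) - 2 * r * (r - 1) * (z t \<bullet> v t)"
    have dz: "(z has_vector_derivative v t) (at t)"
      using t by (intro z) auto
    have "(y has_vector_derivative ((2 * r) *\<^sub>R v t
        + (t *\<^sub>R (- ((3 * r / t) *\<^sub>R v t) - g t) + 1 *\<^sub>R (v t + \<beta> *\<^sub>R g t)))) (at t)"
      unfolding y_def
      by (rule has_vector_derivative_add has_vector_derivative_scaleR DERIV_ident w dz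
          bounded_linear.has_vector_derivative[OF bounded_linear_scaleR_right] | use t in simp)+
    \<comment> \<open>The velocity coefficient is \<open>2 * r - 3 * r + 1\<close>: the factor
      \<open>t\<close> in \<open>y\<close> turns the friction \<open>3 * r / t\<close> into a
      constant.\<close>
    moreover have "(2 * r) *\<^sub>R v t + (t *\<^sub>R (- ((3 * r / t) *\<^sub>R v t) - g t) + 1 *\<^sub>R (v t + \<beta> *\<^sub>R g t))
        = (1 - r) *\<^sub>R v t - (t - \<beta>) *\<^sub>R g t" (is "_ = ?y'")
      using t by (simp add: algebra_simps flip: scaleR_add_left)
    ultimately have dy: "(y has_vector_derivative ?y') (at t)"
      by simp
    have inner: "((\<lambda>s. f s \<bullet> f s) has_real_derivative 2 * (f t \<bullet> f')) (at t)"
      if "(f has_vector_derivative f') (at t)" for f :: "real \<Rightarrow> 'a" and f'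
      unfolding has_field_derivative_def
      by (rule has_derivative_eq_rhs[OF has_derivative_inner[OF that[unfolded has_vector_derivative_def]
          that[unfolded has_vector_derivative_def]]]) (simp add: fun_eq_iff inner_commute)
    have dG: "(G has_real_derivative G') (at t)"
      unfolding G_def G'_def
      by (rule derivative_eq_intros inner[OF dy] inner[OF dz] F refl | use t in simp)+
    have "((\<lambda>s. s powr (2 * r - 2)) has_real_derivative (2 * r - 2) * t powr (2 * r - 2 - 1)) (at t)"
      using t by (intro has_real_derivative_powr) auto
    note dE = DERIV_mult[OF this dG]
    \<comment> \<open>This exposes the common positive factor of both terms of the product
      rule.\<close>
    have pow: "t powr (2 * r - 2) = t powr (2 * r - 2 - 1) * t"
      using t powr_add[of t "2 * r - 2 - 1" 1] by simp
    have "(2 * r - 2) * G t + t * G' \<le> 0"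
      unfolding G_def G'_def y_def
      by (subst energy_rate_identity, rule energy_rate_nonpos[where \<mu> = \<mu>])
        (use r \<beta> \<mu> t Fg[of t] nonneg[of t] in auto)
    then have "t powr (2 * r - 2 - 1) * ((2 * r - 2) * G t + t * G') \<le> 0"
      by (rule mult_nonneg_nonpos[rotated]) simp
    then have "(2 * r - 2) * t powr (2 * r - 2 - 1) * G t + G' * t powr (2 * r - 2) \<le> 0"
      by (simp only: pow) (simp add: algebra_simps)
    with dE show ?thesis
      unfolding E_def by blast
  qed
  have bound: "F t \<le> 2 * E T * t powr (- (2 * r))" if "t \<ge> T" for t
  proof -
    note t = T[OF that]
    have "E t \<le> E T"
      by (rule DERIV_nonpos_imp_nonincreasing[OF that]) (use dE in auto)
    \<comment> \<open>The only negative square in the energy is charged to \<open>F\<close> by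
      quadratic growth; half of \<open>t\<^sup>2\<close> still remains as coefficient of
      \<open>F\<close> by the fourth condition on \<open>T\<close>.\<close>
    have "r * (r - 1) * (z t \<bullet> z t) = 2 * r * (r - 1) / \<mu> * (\<mu> / 2 * (z t \<bullet> z t))"
      using \<mu> by simp
    also have "\<dots> \<le> 2 * r * (r - 1) / \<mu> * F t"
      using r \<mu> t Fz[of t] by (intro mult_left_mono) auto
    finally have "(t\<^sup>2 - (\<beta> * r * t + 2 * r * (r - 1) / \<mu>)) * F t \<le> G t"
      unfolding G_def using inner_ge_zero[of "y t"] by (simp only: left_diff_distrib distrib_right)
    moreover have "t\<^sup>2 / 2 * F t \<le> (t\<^sup>2 - (\<beta> * r * t + 2 * r * (r - 1) / \<mu>)) * F t"
      using t nonneg[of t] by (intro mult_right_mono) auto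
    ultimately have "t powr (2 * r - 2) * (t\<^sup>2 / 2 * F t) \<le> E t"
      unfolding E_def by (intro mult_left_mono) auto
    moreover have "t powr (2 * r - 2) * t\<^sup>2 = t powr (2 * r)"
      using t by (simp add: powr_diff)
    ultimately have "t powr (2 * r) * F t \<le> 2 * E T"
      using \<open>E t \<le> E T\<close> by (simp add: mult.assoc[symmetric])
    then show ?thesis
      using t by (simp add: powr_minus field_simps)
  qed
  show ?thesis
  proof (rule bigoI)
    show "\<forall>\<^sub>F t in at_top. norm (F t) \<le> (2 * E T) * norm (t powr (- (2 * r)))"
      using eventually_ge_at_top[of T]
      by eventually_elim (use bound nonneg T in auto)
  qed
qed

section \<open>Convergence rates for solutions\<close>

theorem theorem3p1:
  fixes \<alpha> \<beta> t0 :: real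
    and \<Phi> :: "'a::{real_inner, complete_space} \<Rightarrow> real"
  assumes "\<alpha> \<ge> 3" and "\<beta> > 0" and "t0 > 0"
    and "twice_continuously_differentiable \<Phi>"
    and "strongly_convex \<Phi>"
  shows "\<exists>xstar. argmin \<Phi> = {xstar} \<and>
    (\<forall>x. is_solution \<alpha> \<beta> t0 \<Phi> x \<longrightarrow>
      (\<lambda>t. \<Phi> (x t) - (INF y. \<Phi> y)) \<in> O[at_top](\<lambda>t. t powr (- (2 * \<alpha> / 3))) \<and>
      (\<lambda>t. norm (x t - xstar)) \<in> O[at_top](\<lambda>t. t powr (- (\<alpha> / 3))))"
proof -
  obtain D D2 where D: "\<And>x. (\<Phi> has_derivative blinfun_apply (D x)) (at x)"
    and D2: "\<And>x. (D has_derivative blinfun_apply (D2 x)) (at x)"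
    using assms(4) unfolding twice_continuously_differentiable_def by blast
  obtain \<mu> where \<mu>: "\<mu> > 0" and conv: "convex_on UNIV (\<lambda>x. \<Phi> x - \<mu> / 2 * (norm x)\<^sup>2)"
    using assms(5) unfolding strongly_convex_def by blast
  obtain m where m: "\<And>y. \<Phi> m \<le> \<Phi> y"
    using strongly_convex_has_minimum[OF conv \<mu>] D unfolding differentiable_def by blast
  have tangent: "\<Phi> x + grad \<Phi> x \<bullet> (y - x) + \<mu> / 2 * ((y - x) \<bullet> (y - x)) \<le> \<Phi> y" for x y
    using strongly_convex_above_tangent[OF conv D, of x y]
    by (simp add: grad_inner[OF D] power2_norm_eq_inner)
  have "blinfun_apply (D m) = (\<lambda>h. 0)"
    by (rule has_derivative_local_min[OF D]) (use m in simp)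
  then have growth: "\<mu> / 2 * ((y - m) \<bullet> (y - m)) \<le> \<Phi> y - \<Phi> m" for y
    using tangent[of m y] by (simp add: grad_inner[OF D])
  have "y = m" if "\<Phi> y \<le> \<Phi> m" for y
  proof -
    have "\<mu> / 2 * ((y - m) \<bullet> (y - m)) \<le> 0"
      using growth[of y] that by linarith
    then show ?thesis
      using \<mu> by (simp add: mult_le_0_iff flip: power2_norm_eq_inner)
  qed
  then have argmin: "argmin \<Phi> = {m}"
    using m by (auto simp: argmin_def is_arg_min_linorder)
  have Inf: "(INF y. \<Phi> y) = \<Phi> m"
    by (rule cInf_eq_minimum) (use m in auto)
  have "(\<lambda>t. \<Phi> (x t) - \<Phi> m) \<in> O[at_top](\<lambda>t. t powr (- (2 * \<alpha> / 3)))
      \<and> (\<lambda>t. norm (x t - m)) \<in> O[at_top](\<lambda>t. t powr (- (\<alpha> / 3)))"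
    if sol: "is_solution \<alpha> \<beta> t0 \<Phi> x" for x
  proof -
    obtain v a where v: "\<And>t. t \<ge> t0 \<Longrightarrow> (x has_vector_derivative v t) (at t within {t0..})"
      and a: "\<And>t. t \<ge> t0 \<Longrightarrow> (v has_vector_derivative a t) (at t within {t0..})"
      and ode: "\<And>t. t \<ge> t0 \<Longrightarrow>
        a t + (\<alpha> / t) *\<^sub>R v t + \<beta> *\<^sub>R hessian \<Phi> (x t) (v t) + grad \<Phi> (x t) = 0"
      using sol unfolding is_solution_def by blast
    \<comment> \<open>Dropping the endpoint turns one-sided derivatives into two-sided ones and does
      not affect the asymptotics.\<close>
    have interior: "at t within {t0..} = at t" if "t > t0" for t
      using that by (intro at_within_interior) simp
    have x': "(x has_vector_derivative v t) (at t)" and v': "(v has_vector_derivative a t) (at t)"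
      if "t > t0" for t
      using v[of t] a[of t] that by (simp_all add: interior)
    have F: "(\<lambda>t. \<Phi> (x t) - \<Phi> m) \<in> O[at_top](\<lambda>t. t powr (- (2 * (\<alpha> / 3))))"
    proof (rule hessian_damped_energy_decay[where z = "\<lambda>t. x t - m" and v = v and \<beta> = \<beta>
          and g = "\<lambda>t. grad \<Phi> (x t)" and ?t0.0 = t0 and \<mu> = \<mu>])
      show "1 \<le> \<alpha> / 3" "0 < \<beta>" "0 < \<mu>"
        using assms \<mu> by auto
      fix t assume t: "t0 < t"
      show "((\<lambda>t. x t - m) has_vector_derivative v t) (at t)"
        using has_vector_derivative_diff[OF x'[OF t] has_vector_derivative_const[of m]] by simp
      have "((\<lambda>s. grad \<Phi> (x s)) has_derivative (\<lambda>s. hessian \<Phi> (x t) (s *\<^sub>R v t))) (at t)"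
        using x'[OF t] grad_has_derivative_hessian[OF D D2] unfolding has_vector_derivative_def
        by (rule has_derivative_compose)
      moreover have "hessian \<Phi> (x t) (s *\<^sub>R v t) = s *\<^sub>R hessian \<Phi> (x t) (v t)" for s
        using grad_has_derivative_hessian[OF D D2]
        by (rule linear_cmul[OF bounded_linear.linear[OF has_derivative_bounded_linear]])
      ultimately have "((\<lambda>s. grad \<Phi> (x s)) has_vector_derivative hessian \<Phi> (x t) (v t)) (at t)"
        by (simp add: has_vector_derivative_def)
      from has_vector_derivative_add[OF v'[OF t]
          bounded_linear.has_vector_derivative[OF bounded_linear_scaleR_right this, of \<beta>]]
      have "((\<lambda>s. v s + \<beta> *\<^sub>R grad \<Phi> (x s)) has_vector_derivative
          a t + \<beta> *\<^sub>R hessian \<Phi> (x t) (v t)) (at t)" .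
      \<comment> \<open>The first bracket is the left side of the differential equation, hence
        zero.\<close>
      moreover have "a t + \<beta> *\<^sub>R hessian \<Phi> (x t) (v t)
          = (a t + (\<alpha> / t) *\<^sub>R v t + \<beta> *\<^sub>R hessian \<Phi> (x t) (v t) + grad \<Phi> (x t))
            + (- ((3 * (\<alpha> / 3) / t) *\<^sub>R v t) - grad \<Phi> (x t))"
        by simp
      ultimately show "((\<lambda>s. v s + \<beta> *\<^sub>R grad \<Phi> (x s)) has_vector_derivative
          - ((3 * (\<alpha> / 3) / t) *\<^sub>R v t) - grad \<Phi> (x t)) (at t)"
        using ode[of t] t by simp
      have "((\<lambda>s. \<Phi> (x s)) has_derivative (\<lambda>s. D (x t) (s *\<^sub>R v t))) (at t)"
        using x'[OF t] D unfolding has_vector_derivative_def by (rule has_derivative_compose)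
      then have "((\<lambda>s. \<Phi> (x s)) has_real_derivative grad \<Phi> (x t) \<bullet> v t) (at t)"
        by (simp add: has_field_derivative_def grad_inner[OF D] blinfun.scaleR_right mult_commute_abs)
      then show "((\<lambda>s. \<Phi> (x s) - \<Phi> m) has_real_derivative grad \<Phi> (x t) \<bullet> v t) (at t)"
        by (auto intro!: derivative_eq_intros)
      \<comment> \<open>The tangent bound is taken at \<open>x t\<close> and evaluated at the
        minimizer, so the displacement has to be reversed.\<close>
      have "(m - x t) \<bullet> (m - x t) = (x t - m) \<bullet> (x t - m)"
        "grad \<Phi> (x t) \<bullet> (m - x t) = - (grad \<Phi> (x t) \<bullet> (x t - m))"
        by (simp_all add: inner_diff_left inner_diff_right)
      then show "\<Phi> (x t) - \<Phi> m + \<mu> / 2 * ((x t - m) \<bullet> (x t - m)) \<le> grad \<Phi> (x t) \<bullet> (x t - m)"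
        using tangent[of "x t" m] by simp
      show "\<mu> / 2 * ((x t - m) \<bullet> (x t - m)) \<le> \<Phi> (x t) - \<Phi> m"
        by (rule growth)
    qed
    then obtain C where "C > 0"
      and C: "\<forall>\<^sub>F t in at_top. norm (\<Phi> (x t) - \<Phi> m) \<le> C * norm (t powr (- (2 * (\<alpha> / 3))))"
      by (rule landau_o.bigE)
    \<comment> \<open>Quadratic growth bounds the squared distance by \<open>2 / \<mu>\<close> times
      the gap in values; the square root halves the exponent.\<close>
    have "\<forall>\<^sub>F t in at_top. norm (norm (x t - m)) \<le> sqrt (2 * C / \<mu>) * norm (t powr (- (\<alpha> / 3)))"
      using C
    proof eventually_elim
      case (elim t)
      have "\<mu> / 2 * (norm (x t - m))\<^sup>2 \<le> C * t powr (- (2 * (\<alpha> / 3)))"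
        using growth[of "x t"] elim by (simp add: power2_norm_eq_inner)
      moreover have "t powr (- (2 * (\<alpha> / 3))) = (t powr (- (\<alpha> / 3)))\<^sup>2"
        by (simp add: power2_eq_square flip: powr_add)
      ultimately have "(norm (x t - m))\<^sup>2 \<le> 2 * C / \<mu> * (t powr (- (\<alpha> / 3)))\<^sup>2"
        using \<mu> by (simp add: field_simps)
      then have "norm (x t - m) \<le> sqrt (2 * C / \<mu> * (t powr (- (\<alpha> / 3)))\<^sup>2)"
        by (rule real_le_rsqrt)
      then show ?case
        by (simp only: real_sqrt_mult real_sqrt_abs) simp
    qed
    then have "(\<lambda>t. norm (x t - m)) \<in> O[at_top](\<lambda>t. t powr (- (\<alpha> / 3)))"
      by (rule bigoI)
    with F show ?thesis
      by simp
  qed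
  with argmin Inf show ?thesis
    by auto
qed

end
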